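(* Let $\mathbb{F}$ be an arbitrary field, let $P(\lambda)=\sum_{k=0}^dP_k\lambda^k\in\mathbb{F}[\lambda]^{n\times n}$ have odd degree $d$, let $s=(d-1)/2\geq 1$, let $\sigma\in\{1,-1\}$, let $\lambda B+A$ be a pencil of size $(s+1)n\times(s+1)n$ over $\mathbb{F}$, and let $$\mathcal{L}(\lambda)=\begin{bmatrix}\lambda B+A & L_s(\lambda)^T\otimes I_n\\ \sigma L_s(\lambda)\otimes I_n & 0\end{bmatrix}.$$ Partition $A$ and $B$ into $(s+1)\times(s+1)$ blocks $A_{ij},B_{ij}\in\mathbb{F}^{n\times n}$, $i,j=1,\dots,s+1$. Then either of the following conditions implies that $\mathcal{L}(\lambda)$ is a strong linearization of $P(\lambda)$: (a) $\displaystyle\sum_{i+j=d+2-k}B_{ij}+\sum_{i+j=d+1-k}A_{ij}=P_k$ for $k=0,1,\dots,d$ (sums over indices $1\le i,j\le s+1$); (b) $P(\lambda)=\mathrm{su}\big((\lambda B+A)\odot\Gamma_s(\lambda)\big)$.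
   Context: For $k\ge 1$, $L_k(\lambda)\in\mathbb{F}[\lambda]^{k\times(k+1)}$ is the matrix with $-1$ in the $(i,i)$ entries, $\lambda$ in the $(i,i+1)$ entries ($i=1,\dots,k$), and zeros elsewhere; $\Lambda_k(\lambda)^T=\begin{bmatrix}\lambda^k&\cdots&\lambda&1\end{bmatrix}$; $\Gamma_s(\lambda)=(\Lambda_s(\lambda)\otimes I_n)(\Lambda_s(\lambda)^T\otimes I_n)$, the block matrix whose $(i,j)$ block is $\lambda^{2s+2-i-j}I_n$. For a block matrix with $n\times n$ blocks $X_{ij}$, $\mathrm{su}(X)=\sum_{i,j}X_{ij}$; for two conformably partitioned block matrices, $X\odot Y$ is the block matrix with $(i,j)$ block $X_{ij}Y_{ij}$. A pencil $L(\lambda)=\lambda X+Y$ is a linearization of $P(\lambda)$ if there exist unimodular matrix polynomials $U(\lambda),V(\lambda)$ with $U(\lambda)L(\lambda)V(\lambda)=\mathrm{diag}(I_m,P(\lambda))$ for some natural number $m$; it is a strong linearization of $P(\lambda)$ (of degree $d$) if in addition $\mathrm{rev}_1L(\lambda)=\lambda Y+X$ is a linearization of $\mathrm{rev}_dP(\lambda)=\lambda^dP(\lambda^{-1})$. *)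

theory Defs
  imports "Jordan_Normal_Form.Determinant" "HOL-Computational_Algebra.Polynomial"
begin

text \<open>
  Matrix polynomials over a field are matrices with polynomial entries, so
  \<open>[:0, 1:]\<close> is the indeterminate.
\<close>

definition const_mat :: "'a::zero mat \<Rightarrow> 'a poly mat" where
  "const_mat X = map_mat (\<lambda>c. [:c:]) X"

definition coeff_mat :: "'a::zero poly mat \<Rightarrow> nat \<Rightarrow> 'a mat" where
  "coeff_mat P k = map_mat (\<lambda>p. coeff p k) P"

text \<open>
  The degree is the largest \<open>k\<close> with \<open>coeff_mat P k \<noteq> 0\<close>; the zero matrix polynomial
  (and a matrix without entries) is given degree 0.
\<close>

definition mat_degree :: "'a::zero poly mat \<Rightarrow> nat" where
  "mat_degree P = Max (insert 0 {degree (P $$ (i, j)) | i j. i < dim_row P \<and> j < dim_col P})"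

text \<open>
  \<open>mat_rev d P\<close> is $\lambda^d P(\lambda^{-1}) = \sum_{k \le d} P_k \lambda^{d-k}$; it is meant for
  \<open>mat_degree P \<le> d\<close>.
\<close>

definition mat_rev :: "nat \<Rightarrow> 'a::comm_monoid_add poly mat \<Rightarrow> 'a poly mat" where
  "mat_rev d P = map_mat (\<lambda>p. \<Sum>k\<le>d. monom (coeff p k) (d - k)) P"

text \<open>\<open>pencil X Y\<close> is $\lambda X + Y$.\<close>

definition pencil :: "'a::comm_semiring_1 mat \<Rightarrow> 'a mat \<Rightarrow> 'a poly mat" where
  "pencil X Y = [:0, 1:] \<cdot>\<^sub>m const_mat X + const_mat Y"

definition is_pencil :: "'a::comm_semiring_1 poly mat \<Rightarrow> bool" where
  "is_pencil L \<longleftrightarrow> (\<exists>X Y. X \<in> carrier_mat (dim_row L) (dim_col L) \<and>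
     Y \<in> carrier_mat (dim_row L) (dim_col L) \<and> L = pencil X Y)"

definition unimodular :: "'a::field poly mat \<Rightarrow> bool" where
  "unimodular U \<longleftrightarrow> square_mat U \<and> (\<exists>c. c \<noteq> 0 \<and> det U = [:c:])"

definition diag_block2 :: "'a::zero mat \<Rightarrow> 'a mat \<Rightarrow> 'a mat" where
  "diag_block2 X Y = four_block_mat X (0\<^sub>m (dim_row X) (dim_col Y)) (0\<^sub>m (dim_row Y) (dim_col X)) Y"

text \<open>
  The carrier conditions make the products below genuine ones (matrix multiplication is a
  total function here); the equation then also forces \<open>L\<close> to have \<open>m\<close> more rows and
  columns than \<open>P\<close>.
\<close>

definition is_linearization :: "'a::field poly mat \<Rightarrow> 'a poly mat \<Rightarrow> bool" where
  "is_linearization L P \<longleftrightarrow> is_pencil L \<and>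
     (\<exists>m U V. U \<in> carrier_mat (dim_row L) (dim_row L) \<and> unimodular U \<and>
              V \<in> carrier_mat (dim_col L) (dim_col L) \<and> unimodular V \<and>
              U * L * V = diag_block2 (1\<^sub>m m) P)"

definition is_strong_linearization :: "'a::field poly mat \<Rightarrow> 'a poly mat \<Rightarrow> bool" where
  "is_strong_linearization L P \<longleftrightarrow>
     is_linearization L P \<and> is_linearization (mat_rev 1 L) (mat_rev (mat_degree P) P)"

definition kronecker :: "'a::times mat \<Rightarrow> 'a mat \<Rightarrow> 'a mat" (infixl \<open>\<otimes>\<^sub>K\<close> 71) where
  "X \<otimes>\<^sub>K Y = mat (dim_row X * dim_row Y) (dim_col X * dim_col Y)
     (\<lambda>(i, j). X $$ (i div dim_row Y, j div dim_col Y) * Y $$ (i mod dim_row Y, j mod dim_col Y))"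

text \<open>
  Matrix entries are indexed from 0, whereas block indices start at 1 in \<open>mat_block\<close>:
  \<open>mat_block n X i j\<close> is the block $X_{ij}$ in the partition of \<open>X\<close> into \<open>n\<times>n\<close> blocks.
\<close>

definition mat_block :: "nat \<Rightarrow> 'a mat \<Rightarrow> nat \<Rightarrow> nat \<Rightarrow> 'a mat" where
  "mat_block n X i j = mat n n (\<lambda>(a, b). X $$ ((i - 1) * n + a, (j - 1) * n + b))"

text \<open>Sum of a finite family of \<open>n\<times>n\<close> matrices.\<close>

definition mat_sum :: "nat \<Rightarrow> ('i \<Rightarrow> 'a::comm_monoid_add mat) \<Rightarrow> 'i set \<Rightarrow> 'a mat" where
  "mat_sum n F I = mat n n (\<lambda>(a, b). \<Sum>x\<in>I. F x $$ (a, b))"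

definition block_su :: "nat \<Rightarrow> 'a::comm_monoid_add mat \<Rightarrow> 'a mat" where
  "block_su n X = mat_sum n (\<lambda>(i, j). mat_block n X i j)
     ({1..dim_row X div n} \<times> {1..dim_col X div n})"

text \<open>
  The block matrix whose \<open>(i, j)\<close> block is the matrix product $X_{ij} Y_{ij}$, for conformably
  partitioned \<open>X\<close> and \<open>Y\<close> with \<open>n\<times>n\<close> blocks.
\<close>

definition block_odot :: "nat \<Rightarrow> 'a::semiring_0 mat \<Rightarrow> 'a mat \<Rightarrow> 'a mat" where
  "block_odot n X Y = mat (dim_row X) (dim_col X)
     (\<lambda>(i, j). (mat_block n X (i div n + 1) (j div n + 1) * mat_block n Y (i div n + 1) (j div n + 1))
        $$ (i mod n, j mod n))"

definition L_mat :: "nat \<Rightarrow> 'a::comm_ring_1 poly mat" where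
  "L_mat k = mat k (k + 1) (\<lambda>(i, j). if j = i then - 1 else if j = i + 1 then [:0, 1:] else 0)"

definition Lambda_vec :: "nat \<Rightarrow> 'a::comm_semiring_1 poly mat" where
  "Lambda_vec k = mat (k + 1) 1 (\<lambda>(i, j). [:0, 1:] ^ (k - i))"

definition Gamma_mat :: "nat \<Rightarrow> nat \<Rightarrow> 'a::comm_semiring_1 poly mat" where
  "Gamma_mat n s = (Lambda_vec s \<otimes>\<^sub>K 1\<^sub>m n) * (transpose_mat (Lambda_vec s) \<otimes>\<^sub>K 1\<^sub>m n)"

definition block_kronecker_pencil ::
    "nat \<Rightarrow> nat \<Rightarrow> 'a::field \<Rightarrow> 'a mat \<Rightarrow> 'a mat \<Rightarrow> 'a poly mat" where
  "block_kronecker_pencil n s \<sigma> A B =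
     four_block_mat (pencil B A)              (transpose_mat (L_mat s) \<otimes>\<^sub>K 1\<^sub>m n)
                    ([:\<sigma>:] \<cdot>\<^sub>m L_mat s \<otimes>\<^sub>K 1\<^sub>m n)   (0\<^sub>m (s * n) (s * n))"

end

theory Submission
  imports Defs
begin

text \<open>
  Complete $L_s$ by a unit row to a square matrix with a polynomial inverse $Q_0$, and put
  $Q = Q_0 \otimes I_n$. Then $(L_s \otimes I_n) Q = [I \; 0]$ and the last $n$ columns of $Q$ are
  $\Lambda_s \otimes I_n$. With $M = \lambda B + A$, the congruence by $\mathrm{diag}(Q, I)$ turns
  the pencil into one whose off-diagonal blocks are constant, and eliminating with them leaves
  $\mathrm{diag}(I, (\Lambda_s^T \otimes I_n) M (\Lambda_s \otimes I_n))$. The last block is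
  $\sum_{i,j} \lambda^{2s+2-i-j} M_{ij}$, and each of (a) and (b) says that it equals $P$.
  The reversed pencil has the same shape, with $(1, \lambda, \ldots, \lambda^s)$ in place of
  $\Lambda_s$, so the same elimination leaves $\mathrm{rev}_d P$.
\<close>

subsection \<open>Unimodular equivalence\<close>

text \<open>The two determinants multiply to 1, so both are units, and the units of a polynomial
  ring over a field are the nonzero constants.\<close>

lemma unimodularI:
  assumes "U \<in> carrier_mat n n" "U' \<in> carrier_mat n n" "U * U' = 1\<^sub>m n"
  shows "unimodular U" "unimodular U'"
proof -
  have "det U * det U' = 1"
    using det_mult[OF assms(1,2)] assms(3) by simp
  then have "det U dvd 1" "det U' dvd 1"
    by (metis dvd_triv_left, metis dvd_triv_right)
  then show "unimodular U" "unimodular U'"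
    using assms(1,2) by (auto simp: unimodular_def is_unit_poly_iff)
qed

lemma unimodular_mult:
  assumes "U \<in> carrier_mat n n" "U' \<in> carrier_mat n n" "unimodular U" "unimodular U'"
  shows "unimodular (U * U')"
  using assms by (force simp: unimodular_def det_mult)

lemma unimodular_transpose:
  assumes "U \<in> carrier_mat n n" "unimodular U"
  shows "unimodular (transpose_mat U)"
  using assms det_transpose[OF assms(1)] by (auto simp: unimodular_def)

text \<open>The relation inside \<open>is_linearization\<close> with an arbitrary target, so that
  the elimination can be done in stages and chained by transitivity.\<close>

definition unimodular_equiv :: "'a::field poly mat \<Rightarrow> 'a poly mat \<Rightarrow> bool" where
  "unimodular_equiv L R \<longleftrightarrow> (\<exists>U V. U \<in> carrier_mat (dim_row L) (dim_row L) \<and> unimodular U \<and>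
     V \<in> carrier_mat (dim_col L) (dim_col L) \<and> unimodular V \<and> U * L * V = R)"

lemma unimodular_equivI:
  assumes "L \<in> carrier_mat m n" "U \<in> carrier_mat m m" "unimodular U"
    "V \<in> carrier_mat n n" "unimodular V" "U * L * V = R"
  shows "unimodular_equiv L R"
  using assms unfolding unimodular_equiv_def by blast

lemma unimodular_equiv_trans [trans]:
  assumes "unimodular_equiv L M" "unimodular_equiv M R"
  shows "unimodular_equiv L R"
proof -
  obtain r c where L: "L \<in> carrier_mat r c" by blast
  then obtain U V where U: "U \<in> carrier_mat r r" "unimodular U"
    and V: "V \<in> carrier_mat c c" "unimodular V" and M: "U * L * V = M"
    using assms(1) unfolding unimodular_equiv_def by auto
  have "M \<in> carrier_mat r c" using U(1) L V(1) M by auto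
  then obtain U' V' where U': "U' \<in> carrier_mat r r" "unimodular U'"
    and V': "V' \<in> carrier_mat c c" "unimodular V'" and R: "U' * M * V' = R"
    using assms(2) unfolding unimodular_equiv_def by auto
  have UL: "U * L \<in> carrier_mat r c" "U' * U * L \<in> carrier_mat r c"
    using U(1) U'(1) L by auto
  have "(U' * U) * L * (V * V') = R"
    using assoc_mult_mat[OF UL(2) V(1) V'(1)] assoc_mult_mat[OF U'(1) U(1) L]
      assoc_mult_mat[OF U'(1) UL(1) V(1)] M R by metis
  moreover have "unimodular (U' * U)" "unimodular (V * V')"
    using unimodular_mult U U' V V' by blast+
  ultimately show ?thesis
    using L mult_carrier_mat[OF U'(1) U(1)] mult_carrier_mat[OF V(1) V'(1)]
    by (intro unimodular_equivI)
qed

text \<open>Block elimination with pivot \<open>A\<close>: what remains is the Schur complement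
  \<open>D - C * A' * B\<close>, which the last assumption reduces to \<open>D\<close>.\<close>

lemma unimodular_equiv_schur:
  assumes A: "A \<in> carrier_mat p p" and A': "A' \<in> carrier_mat p p" and inv: "A' * A = 1\<^sub>m p"
    and B: "B \<in> carrier_mat p q" and C: "C \<in> carrier_mat q p" and D: "D \<in> carrier_mat q q"
    and "C * A' * B = 0\<^sub>m q q"
  shows "unimodular_equiv (four_block_mat A B C D) (diag_block2 (1\<^sub>m p) D)"
proof (rule unimodular_equivI)
  \<comment> \<open>\<open>?U\<close> normalizes the pivot to the identity and clears
    \<open>C\<close>; \<open>?V\<close> then clears the block \<open>A' * B\<close> that is left to
    the right of the identity.\<close>
  let ?U = "four_block_mat A' (0\<^sub>m p q) (- (C * A')) (1\<^sub>m q)"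
  let ?V = "four_block_mat (1\<^sub>m p) (- (A' * B)) (0\<^sub>m q p) (1\<^sub>m q)"
  show "?U \<in> carrier_mat (p + q) (p + q)" "?V \<in> carrier_mat (p + q) (p + q)"
    "four_block_mat A B C D \<in> carrier_mat (p + q) (p + q)"
    using assms by auto
  have carr: "C * A' \<in> carrier_mat q p" "A' * B \<in> carrier_mat p q" using assms by auto
  have "det A' * det A = 1" using det_mult[OF A' A] inv by simp
  moreover have "det ?U = det A'"
    using A' carr by (subst det_four_block_mat_upper_right_zero[of _ p _ q]) auto
  ultimately have "det ?U dvd 1" by (metis dvd_triv_left)
  then show "unimodular ?U" using A' by (auto simp: unimodular_def is_unit_poly_iff)
  have "det ?V = 1"
    using carr by (subst det_four_block_mat_lower_left_zero[of _ p _ q]) auto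
  then show "unimodular ?V" by (auto simp: unimodular_def one_pCons)
  have CA: "C * A' * A = C" using assms by (simp add: assoc_mult_mat[OF C A' A])
  have 1: "- (C * A') * A + 1\<^sub>m q * C = 0\<^sub>m q p" using assms CA carr by auto
  have 2: "- (C * A') * B + 1\<^sub>m q * D = D" using assms carr by (intro eq_matI) auto
  have "?U * four_block_mat A B C D = four_block_mat (1\<^sub>m p) (A' * B) (0\<^sub>m q p) D"
    using assms carr 1 2 by (subst mult_four_block_mat[of _ p p _ q _ q _ _ p _ q]) auto
  also have "\<dots> * ?V = four_block_mat (1\<^sub>m p) (0\<^sub>m p q) (0\<^sub>m q p) D"
    using assms carr by (subst mult_four_block_mat[of _ p p _ q _ q _ _ p _ q])
      (auto simp: uminus_l_inv_mat)
  finally show "?U * four_block_mat A B C D * ?V = diag_block2 (1\<^sub>m p) D"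
    using D by (simp add: diag_block2_def)
qed

lemma unimodular_equiv_swap:
  assumes A: "A \<in> carrier_mat p q" and B: "B \<in> carrier_mat p r"
    and C: "C \<in> carrier_mat t q" and D: "D \<in> carrier_mat t r"
    and pt: "p + t = q + r"
  shows "unimodular_equiv (four_block_mat A B C D) (four_block_mat D C B A)"
proof (rule unimodular_equivI)
  \<comment> \<open>\<open>?S p t\<close> exchanges block rows of heights \<open>p\<close> and
    \<open>t\<close>. It is inverted by \<open>?S t p\<close>, so its unimodularity follows without
    computing the sign of the permutation.\<close>
  let ?S = "\<lambda>p t. four_block_mat (0\<^sub>m t p) (1\<^sub>m t) (1\<^sub>m p) (0\<^sub>m p t) :: 'a poly mat"
  have S: "?S p t \<in> carrier_mat (p + t) (p + t)" for p t
    unfolding carrier_mat_def by auto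
  have "?S t p * ?S p t = 1\<^sub>m (p + t)" for p t
    by (subst mult_four_block_mat[of _ p t _ p _ t _ _ p _ t]) auto
  then have uni: "unimodular (?S p t)" for p t
    using unimodularI(2)[OF _ S] S by (metis add.commute)
  show "unimodular (?S p t)" "unimodular (?S r q)" by (rule uni)+
  show "?S p t \<in> carrier_mat (p + t) (p + t)" by (rule S)
  show "?S r q \<in> carrier_mat (q + r) (q + r)" using S by (metis add.commute)
  show "four_block_mat A B C D \<in> carrier_mat (p + t) (q + r)" using assms by auto
  have "?S p t * four_block_mat A B C D = four_block_mat C D A B"
    using assms by (subst mult_four_block_mat[of _ t p _ t _ p _ _ q _ r]) auto
  also have "\<dots> * ?S r q = four_block_mat D C B A"
    using assms by (subst mult_four_block_mat[of _ t q _ r _ p _ _ r _ q]) auto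
  finally show "?S p t * four_block_mat A B C D * ?S r q = four_block_mat D C B A" .
qed

subsection \<open>Kronecker products\<close>

text \<open>Division with remainder by \<open>n\<close>: \<open>i\<close> numbers the block and
  \<open>a\<close> the position inside it.\<close>

lemma sum_nat_group: "(\<Sum>k<m * n. f k) = (\<Sum>i<m. \<Sum>a<n. f (i * n + a :: nat))"
  for f :: "nat \<Rightarrow> 'a::comm_monoid_add"
  unfolding sum.nat_group[symmetric]
  by (rule sum.cong, rule refl, subst sum.atLeastLessThan_shift_0) (simp add: lessThan_atLeast0 add.commute)

lemma dim_kronecker [simp]:
  "dim_row (X \<otimes>\<^sub>K Y) = dim_row X * dim_row Y" "dim_col (X \<otimes>\<^sub>K Y) = dim_col X * dim_col Y"
  by (simp_all add: kronecker_def)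

lemma kronecker_carrier [simp]:
  "X \<in> carrier_mat p q \<Longrightarrow> Y \<in> carrier_mat m n \<Longrightarrow> X \<otimes>\<^sub>K Y \<in> carrier_mat (p * m) (q * n)"
  unfolding kronecker_def by auto

lemma div_mod_less:
  assumes "i < p * n"
  shows "i div n < p" "i mod n < (n::nat)"
  using assms by (simp add: less_mult_imp_div_less, metis mod_less_divisor mult_0_right not_gr_zero not_less_zero)

lemma block_index_less: "i < p \<Longrightarrow> a < n \<Longrightarrow> i * n + a < p * (n::nat)"
  by (metis add.commute add_less_cancel_right less_le_trans mult_Suc mult_le_mono1 Suc_leI)

text \<open>The mixed-product rule: the summation index splits into quotient and remainder by
  \<open>n\<close>, and commutativity of the entries factors the resulting double sum.\<close>

lemma kronecker_mult:
  fixes X Y Z W :: "'a::comm_semiring_0 mat"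
  assumes "X \<in> carrier_mat p q" "Y \<in> carrier_mat m n" "Z \<in> carrier_mat q r" "W \<in> carrier_mat n t"
  shows "(X \<otimes>\<^sub>K Y) * (Z \<otimes>\<^sub>K W) = (X * Z) \<otimes>\<^sub>K (Y * W)"
proof (rule eq_matI)
  fix i j assume "i < dim_row ((X * Z) \<otimes>\<^sub>K (Y * W))" "j < dim_col ((X * Z) \<otimes>\<^sub>K (Y * W))"
  then have i: "i < p * m" and j: "j < r * t" using assms by (auto simp: kronecker_def)
  note ij = div_mod_less[OF i] div_mod_less[OF j]
  have "((X \<otimes>\<^sub>K Y) * (Z \<otimes>\<^sub>K W)) $$ (i, j) = (\<Sum>k<q * n.
      (X $$ (i div m, k div n) * Y $$ (i mod m, k mod n)) * (Z $$ (k div n, j div t) * W $$ (k mod n, j mod t)))"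
    using assms i j by (simp add: scalar_prod_def kronecker_def lessThan_atLeast0)
  also have "\<dots> = (\<Sum>k<q. \<Sum>l<n.
      (X $$ (i div m, k) * Y $$ (i mod m, l)) * (Z $$ (k, j div t) * W $$ (l, j mod t)))"
    unfolding sum_nat_group by (intro sum.cong refl) simp
  also have "\<dots> = (\<Sum>k<q. X $$ (i div m, k) * Z $$ (k, j div t)) *
      (\<Sum>l<n. Y $$ (i mod m, l) * W $$ (l, j mod t))"
    unfolding sum_product by (simp add: mult_ac)
  also have "\<dots> = ((X * Z) \<otimes>\<^sub>K (Y * W)) $$ (i, j)"
    using assms i j ij by (simp add: scalar_prod_def kronecker_def lessThan_atLeast0)
  finally show "((X \<otimes>\<^sub>K Y) * (Z \<otimes>\<^sub>K W)) $$ (i, j) = ((X * Z) \<otimes>\<^sub>K (Y * W)) $$ (i, j)" .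
qed (use assms in \<open>auto simp: kronecker_def\<close>)

lemma kronecker_one_one: "(1\<^sub>m p :: 'a::comm_semiring_1 mat) \<otimes>\<^sub>K 1\<^sub>m n = 1\<^sub>m (p * n)"
proof (rule eq_matI)
  fix i j assume "i < dim_row (1\<^sub>m (p * n))" "j < dim_col (1\<^sub>m (p * n))"
  then have ij: "i < p * n" "j < p * n" by auto
  have "i = j \<longleftrightarrow> i div n = j div n \<and> i mod n = j mod n"
    by (metis div_mult_mod_eq)
  then show "(1\<^sub>m p \<otimes>\<^sub>K 1\<^sub>m n) $$ (i, j) = (1\<^sub>m (p * n) :: 'a mat) $$ (i, j)"
    using ij div_mod_less[OF ij(1)] div_mod_less[OF ij(2)] by (auto simp: kronecker_def)
qed (auto simp: kronecker_def)

lemma transpose_kronecker: "transpose_mat (X \<otimes>\<^sub>K Y) = transpose_mat X \<otimes>\<^sub>K transpose_mat Y"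
  by (rule eq_matI) (auto simp: kronecker_def div_mod_less)


subsection \<open>Elimination in block Kronecker pencils\<close>

text \<open>
  Moving \<open>M\<close> to the lower right corner makes the part that is eliminated the leading
  \<open>2m\<times>2m\<close> block; its Schur complement is the lower right block of \<open>Q\<^sup>T M Q\<close>.
\<close>

lemma unimodular_equiv_minimal_basis:
  fixes M K Q C R :: "'a::field poly mat"
  assumes M: "M \<in> carrier_mat (m + n) (m + n)" and K: "K \<in> carrier_mat m (m + n)"
    and Q: "Q \<in> carrier_mat (m + n) (m + n)" and C: "C \<in> carrier_mat (m + n) (m + n)"
    and CQ: "C * Q = 1\<^sub>m (m + n)"
    and KQ: "K * Q = mat m (m + n) (\<lambda>(i, j). if i = j then 1 else 0)"
    and c: "c' * c = (1 :: 'a poly)"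
    and R: "R \<in> carrier_mat n n"
    and RG: "\<And>a b. a < n \<Longrightarrow> b < n \<Longrightarrow> R $$ (a, b) = (transpose_mat Q * M * Q) $$ (m + a, m + b)"
  shows "unimodular_equiv (four_block_mat M (transpose_mat K) (c \<cdot>\<^sub>m K) (0\<^sub>m m m))
    (diag_block2 (1\<^sub>m (m + m)) R)"
proof -
  let ?G = "transpose_mat Q * M * Q"
  let ?E = "mat m (m + n) (\<lambda>(i, j). if i = j then 1 else 0) :: 'a poly mat"
  have G: "?G \<in> carrier_mat (m + n) (m + n)" using M Q by auto
  have uQ: "unimodular Q" using unimodularI(2)[OF C Q CQ] .
  have "unimodular_equiv (four_block_mat M (transpose_mat K) (c \<cdot>\<^sub>m K) (0\<^sub>m m m))
      (four_block_mat (0\<^sub>m m m) (c \<cdot>\<^sub>m K) (transpose_mat K) M)"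
    using M K by (intro unimodular_equiv_swap[of _ "m + n" "m + n" _ m _ m]) auto
  \<comment> \<open>Congruence by \<open>diag(1, Q)\<close>: it turns \<open>K\<close> into
    \<open>?E = [1 0]\<close> and \<open>M\<close> into \<open>?G\<close>.\<close>
  also have "unimodular_equiv (four_block_mat (0\<^sub>m m m) (c \<cdot>\<^sub>m K) (transpose_mat K) M)
      (four_block_mat (0\<^sub>m m m) (c \<cdot>\<^sub>m ?E) (transpose_mat ?E) ?G)"
  proof (rule unimodular_equivI)
    let ?D = "\<lambda>Q. four_block_mat (1\<^sub>m m) (0\<^sub>m m (m + n)) (0\<^sub>m (m + n) m) Q :: 'a poly mat"
    show "four_block_mat (0\<^sub>m m m) (c \<cdot>\<^sub>m K) (transpose_mat K) M \<in> carrier_mat (m + (m + n)) (m + (m + n))"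
      using M by auto
    have D: "?D X \<in> carrier_mat (m + (m + n)) (m + (m + n))" "unimodular (?D X)"
      if "X \<in> carrier_mat (m + n) (m + n)" "unimodular X" for X
    proof -
      show "?D X \<in> carrier_mat (m + (m + n)) (m + (m + n))" using that by auto
      have "det (?D X) = det X"
        using that by (subst det_four_block_mat_upper_right_zero[of _ m _ "m + n"]) auto
      then show "unimodular (?D X)" using that by (auto simp: unimodular_def)
    qed
    have Qt: "transpose_mat Q \<in> carrier_mat (m + n) (m + n)" using Q by auto
    note D' = D[OF Q uQ] D[OF Qt unimodular_transpose[OF Q uQ]]
    show "?D (transpose_mat Q) \<in> carrier_mat (m + (m + n)) (m + (m + n))"
      "unimodular (?D (transpose_mat Q))"
      "?D Q \<in> carrier_mat (m + (m + n)) (m + (m + n))" "unimodular (?D Q)"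
      by (rule D')+
    have KQ': "transpose_mat Q * transpose_mat K = transpose_mat ?E"
      using transpose_mult[OF K Q] KQ by simp
    have "?D (transpose_mat Q) * four_block_mat (0\<^sub>m m m) (c \<cdot>\<^sub>m K) (transpose_mat K) M
        = four_block_mat (0\<^sub>m m m) (c \<cdot>\<^sub>m K) (transpose_mat ?E) (transpose_mat Q * M)"
      using M K Q KQ' by (subst mult_four_block_mat[of _ m m _ "m + n" _ "m + n" _ _ m _ "m + n"]) auto
    also have "\<dots> * ?D Q = four_block_mat (0\<^sub>m m m) (c \<cdot>\<^sub>m ?E) (transpose_mat ?E) ?G"
      using M K Q KQ mult_smult_assoc_mat[OF K Q]
      by (subst mult_four_block_mat[of _ m m _ "m + n" _ "m + n" _ _ m _ "m + n"]) auto
    finally show "?D (transpose_mat Q) * four_block_mat (0\<^sub>m m m) (c \<cdot>\<^sub>m K) (transpose_mat K) M * ?D Q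
        = four_block_mat (0\<^sub>m m m) (c \<cdot>\<^sub>m ?E) (transpose_mat ?E) ?G" .
  qed
  also have "unimodular_equiv (four_block_mat (0\<^sub>m m m) (c \<cdot>\<^sub>m ?E) (transpose_mat ?E) ?G)
      (diag_block2 (1\<^sub>m (m + m)) R)"
  proof -
    \<comment> \<open>The cut is moved from \<open>m + (m + n)\<close> to
      \<open>(m + m) + n\<close>. The zero columns of \<open>?E\<close> become the zero parts of
      \<open>?B\<close> and \<open>?C\<close>, and the pivot \<open>?A\<close> has the explicit
      inverse \<open>?A'\<close>, in which \<open>c'\<close> serves as the inverse of
      \<open>c\<close>.\<close>
    let ?G11 = "mat m m (\<lambda>(i, j). ?G $$ (i, j))"
    let ?A = "four_block_mat (0\<^sub>m m m) (c \<cdot>\<^sub>m 1\<^sub>m m) (1\<^sub>m m) ?G11"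
    let ?A' = "four_block_mat (- (c' \<cdot>\<^sub>m ?G11)) (1\<^sub>m m) (c' \<cdot>\<^sub>m 1\<^sub>m m) (0\<^sub>m m m)"
    let ?B = "mat (m + m) n (\<lambda>(i, j). if i < m then 0 else ?G $$ (i - m, m + j))"
    let ?C = "mat n (m + m) (\<lambda>(i, j). if j < m then 0 else ?G $$ (m + i, j - m))"
    have "four_block_mat (0\<^sub>m m m) (c \<cdot>\<^sub>m ?E) (transpose_mat ?E) ?G = four_block_mat ?A ?B ?C R"
      (is "?l = ?r")
    proof (rule eq_matI)
      show "dim_row ?l = dim_row ?r" "dim_col ?l = dim_col ?r" using R Q by auto
      fix i j assume "i < dim_row ?r" "j < dim_col ?r"
      then have ij: "i < m + m + n" "j < m + m + n" using R by auto
      have RG': "?G $$ (i - m, j - m) = R $$ (i - (m + m), j - (m + m))" if "\<not> i < m + m" "\<not> j < m + m"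
        using that ij by (subst RG) auto
      have "?l $$ (i, j) = (if i < m then if j < m then 0 else if i = j - m then c else 0
          else if j < m then if i - m = j then 1 else 0 else ?G $$ (i - m, j - m))"
        using ij Q by (auto simp del: index_mult_mat(1))
      moreover have "?r $$ (i, j) = (if i < m + m then if j < m + m then
            if i < m then if j < m then 0 else if i = j - m then c else 0
            else if j < m then if i - m = j then 1 else 0 else ?G $$ (i - m, j - m)
          else if i < m then 0 else ?G $$ (i - m, m + (j - (m + m)))
        else if j < m + m then if j < m then 0 else ?G $$ (m + (i - (m + m)), j - m)
        else R $$ (i - (m + m), j - (m + m)))"
        using ij R Q by (auto simp del: index_mult_mat(1))
      moreover have "m + (j - (m + m)) = j - m" if "\<not> j < m + m" for j using that by auto
      ultimately show "?l $$ (i, j) = ?r $$ (i, j)" using RG' by auto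
    qed
    moreover have "unimodular_equiv (four_block_mat ?A ?B ?C R) (diag_block2 (1\<^sub>m (m + m)) R)"
    proof (rule unimodular_equiv_schur)
      show "?A \<in> carrier_mat (m + m) (m + m)" "?A' \<in> carrier_mat (m + m) (m + m)"
        "?B \<in> carrier_mat (m + m) n" "?C \<in> carrier_mat n (m + m)" "R \<in> carrier_mat n n"
        using R by auto
      have "- (c' \<cdot>\<^sub>m ?G11) * (c \<cdot>\<^sub>m 1\<^sub>m m) + 1\<^sub>m m * ?G11 = 0\<^sub>m m m"
      proof -
        have "- (c' \<cdot>\<^sub>m ?G11) * (c \<cdot>\<^sub>m 1\<^sub>m m) = - ?G11"
          using c by (intro eq_matI) (auto simp: mult_smult_distrib[of _ m m _ m] mult.assoc[symmetric] mult.commute[of c c'])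
        then show ?thesis by (simp add: uminus_l_inv_mat)
      qed
      moreover have "(c' \<cdot>\<^sub>m 1\<^sub>m m) * (c \<cdot>\<^sub>m 1\<^sub>m m) + 0\<^sub>m m m * ?G11 = 1\<^sub>m m"
        using c by (intro eq_matI) (auto simp: mult_smult_distrib[of _ m m _ m] mult.commute[of c c'])
      ultimately show "?A' * ?A = 1\<^sub>m (m + m)"
        by (subst mult_four_block_mat[of _ m m _ m _ m _ _ m _ m]) auto
      \<comment> \<open>The left half of \<open>?C\<close> and the lower right block of
        \<open>?A'\<close> are zero, so the right half of \<open>?C * ?A'\<close> vanishes. The
        upper half of \<open>?B\<close> vanishes as well, and together this kills the Schur
        correction.\<close>
      have H: "(?C * ?A') $$ (i, k) = 0" if "i < n" "k < m + m" "\<not> k < m" for i k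
        using that by (auto simp: scalar_prod_def intro!: sum.neutral)
      show "?C * ?A' * ?B = 0\<^sub>m n n"
      proof (rule eq_matI)
        fix i j assume "i < dim_row (0\<^sub>m n n)" "j < dim_col (0\<^sub>m n n)"
        then have ij: "i < n" "j < n" by auto
        have "(?C * ?A' * ?B) $$ (i, j) = (\<Sum>k<m + m. (?C * ?A') $$ (i, k) * ?B $$ (k, j))"
          using ij by (subst index_mult_mat) (auto simp: scalar_prod_def lessThan_atLeast0 simp del: index_mult_mat(1))
        also have "\<dots> = 0"
          using ij H by (intro sum.neutral ballI) (auto simp del: index_mult_mat(1))
        finally show "(?C * ?A' * ?B) $$ (i, j) = 0\<^sub>m n n $$ (i, j)" using ij by simp
      qed auto
    qed
    ultimately show ?thesis by simp
  qed
  finally show ?thesis .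
qed

lemma kronecker_one_index:
  fixes X :: "'a::comm_semiring_1 mat"
  assumes "i < dim_row X * n" "j < dim_col X * n"
  shows "(X \<otimes>\<^sub>K 1\<^sub>m n) $$ (i, j) = (if i mod n = j mod n then X $$ (i div n, j div n) else 0)"
  using assms by (auto simp: kronecker_def div_mod_less)

text \<open>Here \<open>L\<close> is any matrix formed by the first \<open>s\<close> rows of an
  invertible \<open>C\<close>, which covers both \<open>L_mat s\<close> and its reversal. The lower
  right block of the congruence only sees the last block column of the Kronecker product of
  \<open>Q\<close> with the identity, hence only the last column of \<open>Q\<close>.\<close>

lemma block_kronecker_equiv:
  fixes M C Q R :: "'a::field poly mat"
  assumes M: "M \<in> carrier_mat ((s + 1) * n) ((s + 1) * n)" and L: "L \<in> carrier_mat s (s + 1)"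
    and Q: "Q \<in> carrier_mat (s + 1) (s + 1)" and C: "C \<in> carrier_mat (s + 1) (s + 1)"
    and CQ: "C * Q = 1\<^sub>m (s + 1)"
    and CL: "\<And>i j. i < s \<Longrightarrow> j < s + 1 \<Longrightarrow> C $$ (i, j) = L $$ (i, j)"
    and c: "c' * c = (1 :: 'a poly)"
    and R: "R \<in> carrier_mat n n"
    and RM: "\<And>a b. a < n \<Longrightarrow> b < n \<Longrightarrow> R $$ (a, b) =
      (\<Sum>i<s + 1. \<Sum>j<s + 1. Q $$ (i, s) * Q $$ (j, s) * M $$ (i * n + a, j * n + b))"
  shows "unimodular_equiv
    (four_block_mat M (transpose_mat L \<otimes>\<^sub>K 1\<^sub>m n) (c \<cdot>\<^sub>m (L \<otimes>\<^sub>K 1\<^sub>m n)) (0\<^sub>m (s * n) (s * n)))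
    (diag_block2 (1\<^sub>m (s * n + s * n)) R)"
proof -
  let ?I = "1\<^sub>m n :: 'a poly mat"
  have N: "(s + 1) * n = s * n + n" by simp
  have I: "?I \<in> carrier_mat n n" by simp
  \<comment> \<open>The rows of \<open>L\<close> are rows of \<open>C\<close>, so
    \<open>L * Q\<close> consists of the first \<open>s\<close> rows of the identity
    \<open>C * Q\<close>.\<close>
  have LQ: "L * Q = mat s (s + 1) (\<lambda>(i, j). if i = j then 1 else 0)"
  proof (rule eq_matI)
    fix i j assume "i < dim_row (mat s (s + 1) (\<lambda>(i, j). if i = j then 1 else 0 :: 'a poly))"
      "j < dim_col (mat s (s + 1) (\<lambda>(i, j). if i = j then 1 else 0 :: 'a poly))"
    then have ij: "i < s" "j < s + 1" by auto
    then have "row L i = row C i" using L C CL by (intro eq_vecI) auto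
    then have "(L * Q) $$ (i, j) = (C * Q) $$ (i, j)" using ij L C Q by auto
    then show "(L * Q) $$ (i, j) = mat s (s + 1) (\<lambda>(i, j). if i = j then 1 else 0) $$ (i, j)"
      using ij by (simp add: CQ)
  qed (use L Q in auto)
  have "(L \<otimes>\<^sub>K ?I) * (Q \<otimes>\<^sub>K ?I) = mat s (s + 1) (\<lambda>(i, j). if i = j then 1 else 0) \<otimes>\<^sub>K ?I"
    using kronecker_mult[OF L I Q I] LQ by simp
  also have "\<dots> = mat (s * n) (s * n + n) (\<lambda>(i, j). if i = j then 1 else 0)" (is "?l = ?r")
  proof (rule eq_matI)
    fix i j assume "i < dim_row ?r" "j < dim_col ?r"
    then have ij: "i < s * n" "j < (s + 1) * n" by auto
    have "i = j \<longleftrightarrow> i div n = j div n \<and> i mod n = j mod n"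
      by (metis div_mult_mod_eq)
    then show "?l $$ (i, j) = ?r $$ (i, j)"
      using ij div_mod_less[OF ij(1)] div_mod_less[OF ij(2)] by (auto simp: kronecker_one_index)
  qed (auto simp: kronecker_def)
  finally have KQ: "(L \<otimes>\<^sub>K ?I) * (Q \<otimes>\<^sub>K ?I) = mat (s * n) (s * n + n) (\<lambda>(i, j). if i = j then 1 else 0)" .
  have CQ': "(C \<otimes>\<^sub>K ?I) * (Q \<otimes>\<^sub>K ?I) = 1\<^sub>m (s * n + n)"
    using kronecker_mult[OF C I Q I] CQ kronecker_one_one[of "s + 1" n] by (simp add: add.commute)
  let ?Q = "Q \<otimes>\<^sub>K ?I"
  note carr = kronecker_carrier[OF L I, unfolded N] kronecker_carrier[OF Q I, unfolded N]
    kronecker_carrier[OF C I, unfolded N]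
  have M': "M \<in> carrier_mat (s * n + n) (s * n + n)" using M unfolding N .
  have RG: "R $$ (a, b) = (transpose_mat ?Q * M * ?Q) $$ (s * n + a, s * n + b)"
    if ab: "a < n" "b < n" for a b
  proof -
    \<comment> \<open>Column \<open>s * n + a\<close> lies in the last block column, whose blocks
      are the scalar matrices with the entries of the last column of \<open>Q\<close>. These deltas
      collapse the sums over positions inside the blocks below.\<close>
    have Qe: "?Q $$ (i * n + k, s * n + a) = (if k = a then Q $$ (i, s) else 0)"
      if "i < s + 1" "k < n" "a < n" for i k a
      using that Q block_index_less[of i "s + 1" k n] by (subst kronecker_one_index) auto
    have "(transpose_mat ?Q * M * ?Q) $$ (s * n + a, s * n + b) =
        (\<Sum>p<(s + 1) * n. ?Q $$ (p, s * n + a) * (\<Sum>q<(s + 1) * n. M $$ (p, q) * ?Q $$ (q, s * n + b)))"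
      using ab M' carr by (simp add: scalar_prod_def lessThan_atLeast0 add.commute del: dim_kronecker)
    also have "\<dots> = (\<Sum>i<s + 1. \<Sum>l<n. (if l = a then Q $$ (i, s) else 0) *
        (\<Sum>j<s + 1. \<Sum>k<n. M $$ (i * n + l, j * n + k) * (if k = b then Q $$ (j, s) else 0)))"
      unfolding sum_nat_group using ab Qe by (intro sum.cong arg_cong2[where f = "(*)"] refl) auto
    also have "\<dots> = (\<Sum>i<s + 1. Q $$ (i, s) *
        (\<Sum>j<s + 1. \<Sum>k<n. M $$ (i * n + a, j * n + k) * (if k = b then Q $$ (j, s) else 0)))"
      using ab by (simp add: if_distrib[of "\<lambda>x. x * _"] cong: if_cong)
    also have "\<dots> = (\<Sum>i<s + 1. Q $$ (i, s) * (\<Sum>j<s + 1. M $$ (i * n + a, j * n + b) * Q $$ (j, s)))"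
      using ab by (simp add: if_distrib[of "(*) _"] cong: if_cong)
    also have "\<dots> = (\<Sum>i<s + 1. \<Sum>j<s + 1. Q $$ (i, s) * Q $$ (j, s) * M $$ (i * n + a, j * n + b))"
      unfolding sum_distrib_left by (simp only: mult_ac)
    finally show ?thesis using RM ab by simp
  qed
  have "transpose_mat L \<otimes>\<^sub>K ?I = transpose_mat (L \<otimes>\<^sub>K ?I)"
    by (simp add: transpose_kronecker)
  then show ?thesis
    using unimodular_equiv_minimal_basis[OF M' carr CQ' KQ c R RG] by simp
qed

section \<open>Explicit completions of \<open>L_mat s\<close> and of its reversal\<close>

text \<open>Both completions are bidiagonal above an added last row, which \<open>u\<close> leaves
  open; each row of the product becomes a two-term recurrence in the rows of
  \<open>X\<close>.\<close>

lemma bidiagonal_mult: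
  fixes a b :: "'a::comm_semiring_1"
  assumes "i < s" "j < s + 1" "X \<in> carrier_mat (s + 1) (s + 1)"
  shows "(mat (s + 1) (s + 1) (\<lambda>(i, j). if i = s then u j else if j = i then a
      else if j = i + 1 then b else 0) * X) $$ (i, j) = a * X $$ (i, j) + b * X $$ (i + 1, j)"
proof -
  have "(\<Sum>k<s + 1. (if k = i then a else if k = i + 1 then b else 0) * X $$ (k, j)) =
      (\<Sum>k<s + 1. (if k = i then a * X $$ (k, j) else 0) + (if k = i + 1 then b * X $$ (k, j) else 0))"
    by (intro sum.cong) auto
  also have "\<dots> = a * X $$ (i, j) + b * X $$ (i + 1, j)"
    using assms unfolding sum.distrib by simp
  finally show ?thesis
    using assms by (simp add: scalar_prod_def lessThan_atLeast0 del: sum.lessThan_Suc)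
qed

text \<open>The added row is a unit row at a position \<open>t\<close> that differs in the two
  cases: \<open>t = s\<close> completes \<open>L_mat s\<close>, and \<open>t = 0\<close> completes
  its reversal.\<close>

lemma unit_row_mult:
  fixes X :: "'a::comm_semiring_1 mat"
  assumes "t < s + 1" "j < s + 1" "X \<in> carrier_mat (s + 1) (s + 1)"
  shows "(mat (s + 1) (s + 1) (\<lambda>(i, j). if i = s then if j = t then 1 else 0 else g i j) * X) $$ (s, j)
    = X $$ (t, j)"
proof -
  have "(\<Sum>k<s + 1. (if k = t then 1 else 0) * X $$ (k, j)) = (\<Sum>k<s + 1. if k = t then X $$ (k, j) else 0)"
    by (intro sum.cong) auto
  also have "\<dots> = X $$ (t, j)"
    using assms by simp
  finally show ?thesis
    using assms by (simp add: scalar_prod_def lessThan_atLeast0 del: sum.lessThan_Suc)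
qed

lemma block_kronecker_L_equiv:
  fixes M R :: "'a::field poly mat"
  assumes M: "M \<in> carrier_mat ((s + 1) * n) ((s + 1) * n)" and c: "c' * c = (1 :: 'a poly)"
    and R: "R \<in> carrier_mat n n"
    and RM: "\<And>a b. a < n \<Longrightarrow> b < n \<Longrightarrow> R $$ (a, b) =
      (\<Sum>i<s + 1. \<Sum>j<s + 1. [:0, 1:] ^ (s - i) * [:0, 1:] ^ (s - j) * M $$ (i * n + a, j * n + b))"
  shows "unimodular_equiv
    (four_block_mat M (transpose_mat (L_mat s) \<otimes>\<^sub>K 1\<^sub>m n) (c \<cdot>\<^sub>m (L_mat s \<otimes>\<^sub>K 1\<^sub>m n)) (0\<^sub>m (s * n) (s * n)))
    (diag_block2 (1\<^sub>m (s * n + s * n)) R)"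
proof (rule block_kronecker_equiv[OF M _ _ _ _ _ c R])
  let ?x = "[:0, 1:] :: 'a poly"
  \<comment> \<open>\<open>?Q\<close> solves \<open>?C * ?Q = 1\<close> by back substitution: its
    last row is the unit row at \<open>s\<close>, and row \<open>i\<close> is \<open>?x\<close>
    times row \<open>i + 1\<close> minus the unit row at \<open>i\<close>. The last column is
    \<open>Lambda_vec s\<close>.\<close>
  let ?Q = "mat (s + 1) (s + 1) (\<lambda>(i, j). if j = s then ?x ^ (s - i) else if i \<le> j then - (?x ^ (j - i)) else 0)"
  let ?C = "mat (s + 1) (s + 1) (\<lambda>(i, j). if i = s then if j = s then 1 else 0
    else if j = i then - 1 else if j = i + 1 then ?x else 0)"
  show Q: "?Q \<in> carrier_mat (s + 1) (s + 1)" and C: "?C \<in> carrier_mat (s + 1) (s + 1)"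
    and "L_mat s \<in> carrier_mat s (s + 1)" by (auto simp: L_mat_def)
  show "?C * ?Q = 1\<^sub>m (s + 1)"
  proof (rule eq_matI)
    fix i j assume "i < dim_row (1\<^sub>m (s + 1))" "j < dim_col (1\<^sub>m (s + 1))"
    then have ij: "i < s + 1" "j < s + 1" by auto
    show "(?C * ?Q) $$ (i, j) = 1\<^sub>m (s + 1) $$ (i, j)"
    proof (cases "i = s")
      case True
      then show ?thesis
        using ij unit_row_mult[OF _ ij(2) Q, of s] by simp
    next
      case False
      \<comment> \<open>Off the diagonal the two terms of the recurrence cancel by this shift of
        exponents; the bound \<open>k < l\<close> keeps the truncated subtraction exact.\<close>
      have "?x * ?x ^ (l - Suc k) = ?x ^ (l - k)" if "k < l" for k l
        using that by (simp only: power_Suc[symmetric] Suc_diff_Suc)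
      then show ?thesis
        using ij False by (subst bidiagonal_mult[OF _ ij(2) Q]) (auto simp del: mult_pCons_left)
    qed
  qed auto
  show "?C $$ (i, j) = L_mat s $$ (i, j)" if "i < s" "j < s + 1" for i j
    using that by (simp add: L_mat_def)
  show "R $$ (a, b) = (\<Sum>i<s + 1. \<Sum>j<s + 1. ?Q $$ (i, s) * ?Q $$ (j, s) * M $$ (i * n + a, j * n + b))"
    if "a < n" "b < n" for a b
    unfolding RM[OF that] by (intro sum.cong refl) simp
qed

text \<open>The reversal has \<open>-x\<close> on the diagonal and 1 next to it, so its kernel is
  spanned by the powers of \<open>x\<close> in ascending order. The added row must now be the unit
  row at 0: the one at \<open>s\<close> would give the determinant \<open>(-x)^s\<close>.\<close>

lemma block_kronecker_rev_L_equiv: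
  fixes M R :: "'a::field poly mat"
  assumes M: "M \<in> carrier_mat ((s + 1) * n) ((s + 1) * n)" and c: "c' * c = (1 :: 'a poly)"
    and R: "R \<in> carrier_mat n n"
    and RM: "\<And>a b. a < n \<Longrightarrow> b < n \<Longrightarrow> R $$ (a, b) =
      (\<Sum>i<s + 1. \<Sum>j<s + 1. [:0, 1:] ^ i * [:0, 1:] ^ j * M $$ (i * n + a, j * n + b))"
  shows "unimodular_equiv
    (four_block_mat M (transpose_mat (mat_rev 1 (L_mat s)) \<otimes>\<^sub>K 1\<^sub>m n)
      (c \<cdot>\<^sub>m (mat_rev 1 (L_mat s) \<otimes>\<^sub>K 1\<^sub>m n)) (0\<^sub>m (s * n) (s * n)))
    (diag_block2 (1\<^sub>m (s * n + s * n)) R)"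
proof (rule block_kronecker_equiv[OF M _ _ _ _ _ c R])
  let ?x = "[:0, 1:] :: 'a poly"
  \<comment> \<open>This time the recurrence runs forward: row 0 of \<open>?Q\<close> is the unit
    row at \<open>s\<close>, and row \<open>i + 1\<close> is \<open>?x\<close> times row
    \<open>i\<close> plus the unit row at \<open>i\<close>.\<close>
  let ?Q = "mat (s + 1) (s + 1) (\<lambda>(i, j). if j = s then ?x ^ i else if i \<le> j then 0 else ?x ^ (i - 1 - j))"
  let ?C = "mat (s + 1) (s + 1) (\<lambda>(i, j). if i = s then if j = 0 then 1 else 0
    else if j = i then - ?x else if j = i + 1 then 1 else 0)"
  show Q: "?Q \<in> carrier_mat (s + 1) (s + 1)" and C: "?C \<in> carrier_mat (s + 1) (s + 1)"
    and "mat_rev 1 (L_mat s) \<in> carrier_mat s (s + 1)" by (auto simp: L_mat_def mat_rev_def)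
  show "?C * ?Q = 1\<^sub>m (s + 1)"
  proof (rule eq_matI)
    fix i j assume "i < dim_row (1\<^sub>m (s + 1))" "j < dim_col (1\<^sub>m (s + 1))"
    then have ij: "i < s + 1" "j < s + 1" by auto
    show "(?C * ?Q) $$ (i, j) = 1\<^sub>m (s + 1) $$ (i, j)"
    proof (cases "i = s")
      case True
      then show ?thesis
        using ij unit_row_mult[OF _ ij(2) Q, of 0] by simp
    next
      case False
      have "?x * ?x ^ (l - Suc k) = ?x ^ (l - k)" if "k < l" for k l
        using that by (simp only: power_Suc[symmetric] Suc_diff_Suc)
      then show ?thesis
        using ij False by (subst bidiagonal_mult[OF _ ij(2) Q]) (auto simp del: mult_pCons_left minus_pCons)
    qed
  qed auto
  show "?C $$ (i, j) = mat_rev 1 (L_mat s) $$ (i, j)" if "i < s" "j < s + 1" for i j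
    using that by (simp add: L_mat_def mat_rev_def monom_0 monom_Suc one_pCons)
  show "R $$ (a, b) = (\<Sum>i<s + 1. \<Sum>j<s + 1. ?Q $$ (i, s) * ?Q $$ (j, s) * M $$ (i * n + a, j * n + b))"
    if "a < n" "b < n" for a b
    unfolding RM[OF that] by (intro sum.cong refl) simp
qed

subsection \<open>Pencils and reversals\<close>

lemma pencil_index:
  assumes "i < dim_row Y" "j < dim_col Y" "i < dim_row X" "j < dim_col X"
  shows "pencil X Y $$ (i, j) = [:Y $$ (i, j), X $$ (i, j):]"
  using assms by (simp add: pencil_def const_mat_def)

lemma is_pencilI:
  assumes "\<And>i j. i < dim_row L \<Longrightarrow> j < dim_col L \<Longrightarrow> degree (L $$ (i, j)) \<le> 1"
  shows "is_pencil L"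
  unfolding is_pencil_def
proof (intro exI conjI)
  show "coeff_mat L 1 \<in> carrier_mat (dim_row L) (dim_col L)"
    "coeff_mat L 0 \<in> carrier_mat (dim_row L) (dim_col L)"
    by (auto simp: coeff_mat_def)
  have deg: "[:coeff p 0, coeff p 1:] = p" if "degree p \<le> 1" for p :: "'a poly"
    using that by (intro poly_eqI) (auto simp: coeff_pCons coeff_eq_0 split: nat.split)
  show "L = pencil (coeff_mat L 1) (coeff_mat L 0)"
  proof (rule eq_matI)
    fix i j assume "i < dim_row (pencil (coeff_mat L 1) (coeff_mat L 0))"
      "j < dim_col (pencil (coeff_mat L 1) (coeff_mat L 0))"
    then have ij: "i < dim_row L" "j < dim_col L"
      by (auto simp: pencil_def const_mat_def coeff_mat_def)
    then show "L $$ (i, j) = pencil (coeff_mat L 1) (coeff_mat L 0) $$ (i, j)"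
      using deg[OF assms[OF ij]] by (subst pencil_index) (simp_all add: coeff_mat_def)
  qed (auto simp: pencil_def const_mat_def coeff_mat_def)
qed

lemma mat_rev_one_index:
  fixes L :: "'a::comm_monoid_add poly mat"
  assumes "i < dim_row L" "j < dim_col L"
  shows "mat_rev 1 L $$ (i, j) = [:coeff (L $$ (i, j)) 1, coeff (L $$ (i, j)) 0:]"
  using assms by (simp add: mat_rev_def monom_0 monom_Suc)

lemma is_linearizationI:
  assumes "is_pencil L" "unimodular_equiv L (diag_block2 (1\<^sub>m m) P)"
  shows "is_linearization L P"
  using assms unfolding is_linearization_def unimodular_equiv_def by blast

lemma coeff_rev:
  "coeff (\<Sum>k\<le>d. monom (coeff p k) (d - k)) m = (if m \<le> d then coeff p (d - m) else 0)"
proof -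
  \<comment> \<open>For \<open>m > d\<close> the truncated \<open>d - m\<close> is 0, so without the
    conjunct \<open>m \<le> d\<close> the constant coefficient would be picked up.\<close>
  have "coeff (\<Sum>k\<le>d. monom (coeff p k) (d - k)) m = (\<Sum>k\<le>d. if k = d - m \<and> m \<le> d then coeff p k else 0)"
    unfolding coeff_sum coeff_monom by (intro sum.cong) auto
  then show ?thesis by auto
qed

lemma coeff_x_power_mult:
  "coeff ([:0, 1:] ^ e * p) m = (if e \<le> m then coeff p (m - e) else (0 :: 'a::comm_semiring_1))"
  using coeff_monom_mult[of 1 e p m] by (simp add: monom_altdef)

text \<open>Substituting \<open>1/x\<close> into \<open>x^e * (u + v*x)\<close> and multiplying by
  \<open>x^d\<close> leaves \<open>x^(d - e - 1) * (v + u*x)\<close>. This treats one block summand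
  at a time.\<close>

lemma rev_x_power_mult:
  fixes u v :: "'a::comm_ring_1"
  assumes "d = e + f + 1"
  shows "(\<Sum>k\<le>d. monom (coeff ([:0, 1:] ^ e * [:u, v:]) k) (d - k)) = [:0, 1:] ^ f * [:v, u:]"
proof (rule poly_eqI)
  have lin: "coeff [:u, v:] k = (if k = 0 then u else if k = 1 then v else 0)" for u v :: 'a and k
    by (simp add: coeff_pCons split: nat.split)
  show "coeff (\<Sum>k\<le>d. monom (coeff ([:0, 1:] ^ e * [:u, v:]) k) (d - k)) m = coeff ([:0, 1:] ^ f * [:v, u:]) m" for m
    by (subst coeff_rev, unfold coeff_x_power_mult lin assms) auto
qed

lemma coeff_eq_0_mat_degree:
  assumes "i < dim_row P" "j < dim_col P" "mat_degree P < k"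
  shows "coeff (P $$ (i, j)) k = 0"
proof (rule coeff_eq_0)
  let ?D = "{degree (P $$ (i, j)) | i j. i < dim_row P \<and> j < dim_col P}"
  have "?D = (\<lambda>(i, j). degree (P $$ (i, j))) ` ({..<dim_row P} \<times> {..<dim_col P})" by auto
  then have "finite ?D" by simp
  then have "degree (P $$ (i, j)) \<le> mat_degree P"
    unfolding mat_degree_def using assms by (intro Max_ge) auto
  then show "degree (P $$ (i, j)) < k" using assms(3) by simp
qed


subsection \<open>Block sums\<close>

text \<open>Passes from block indices starting at 1 to indices starting at 0, and moves the side
  condition into the summand, so that sums over different index sets can be combined
  termwise.\<close>

lemma mat_sum_blocks:
  assumes "a < n" "b < n"
  shows "mat_sum n (\<lambda>(i, j). mat_block n X i j) {(i, j). i \<in> {1..p} \<and> j \<in> {1..p} \<and> Q i j} $$ (a, b)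
    = (\<Sum>i<p. \<Sum>j<p. if Q (Suc i) (Suc j) then X $$ (i * n + a, j * n + b) else 0)"
proof -
  have "mat_sum n (\<lambda>(i, j). mat_block n X i j) {(i, j). i \<in> {1..p} \<and> j \<in> {1..p} \<and> Q i j} $$ (a, b)
      = (\<Sum>(i, j)\<in>{x \<in> {1..p} \<times> {1..p}. case x of (i, j) \<Rightarrow> Q i j}. X $$ ((i - 1) * n + a, (j - 1) * n + b))"
    using assms unfolding mat_sum_def by (auto simp: mat_block_def intro!: sum.cong)
  also have "\<dots> = (\<Sum>x\<in>{1..p} \<times> {1..p}. case x of (i, j) \<Rightarrow>
      if Q i j then X $$ ((i - 1) * n + a, (j - 1) * n + b) else 0)"
    by (subst sum.inter_filter) (auto intro!: sum.cong)
  also have "\<dots> = (\<Sum>i<p. \<Sum>j<p. if Q (Suc i) (Suc j) then X $$ (i * n + a, j * n + b) else 0)"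
    by (subst sum.cartesian_product[symmetric]) (simp add: sum.atLeast1_atMost_eq cong: if_cong)
  finally show ?thesis .
qed

text \<open>By the mixed-product rule \<open>Gamma_mat n s\<close> is the Kronecker product of a
  rank-one matrix with the identity, so all its blocks are scalar.\<close>

lemma Gamma_mat_index:
  assumes "i < s + 1" "j < s + 1" "a < n" "b < n"
  shows "Gamma_mat n s $$ (i * n + a, j * n + b) =
    (if a = b then [:0, 1:] ^ (s - i) * [:0, 1:] ^ (s - j) else (0 :: 'a::comm_semiring_1 poly))"
proof -
  let ?v = "Lambda_vec s :: 'a poly mat"
  have v: "?v \<in> carrier_mat (s + 1) 1" by (simp add: Lambda_vec_def)
  have I: "1\<^sub>m n \<in> carrier_mat n n" by simp
  have "Gamma_mat n s = (?v * transpose_mat ?v) \<otimes>\<^sub>K 1\<^sub>m n"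
    using kronecker_mult[OF v I, of "transpose_mat ?v" "s + 1" "1\<^sub>m n" n] v by (simp add: Gamma_mat_def)
  then show ?thesis
    using assms v block_index_less[of i "s + 1" a n] block_index_less[of j "s + 1" b n]
    by (auto simp: kronecker_one_index scalar_prod_def Lambda_vec_def)
qed

text \<open>Since the blocks of \<open>Gamma_mat n s\<close> are scalar, the blockwise product only
  scales the blocks of \<open>M\<close>. Condition (b) thus says that \<open>P\<close> is the block
  left by the elimination.\<close>

lemma block_su_odot_Gamma_index:
  fixes M :: "'a::comm_semiring_1 poly mat"
  assumes M: "M \<in> carrier_mat ((s + 1) * n) ((s + 1) * n)" and ab: "a < n" "b < n"
  shows "block_su n (block_odot n M (Gamma_mat n s)) $$ (a, b) =
    (\<Sum>i<s + 1. \<Sum>j<s + 1. [:0, 1:] ^ (s - i) * [:0, 1:] ^ (s - j) * M $$ (i * n + a, j * n + b))"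
proof -
  let ?X = "block_odot n M (Gamma_mat n s)"
  have X: "?X $$ (i * n + a, j * n + b) =
      [:0, 1:] ^ (s - i) * [:0, 1:] ^ (s - j) * M $$ (i * n + a, j * n + b)"
    if ij: "i < s + 1" "j < s + 1" for i j
  proof -
    have "?X $$ (i * n + a, j * n + b) =
        (mat_block n M (Suc i) (Suc j) * mat_block n (Gamma_mat n s) (Suc i) (Suc j)) $$ (a, b)"
      using M ab block_index_less[OF ij(1) ab(1)] block_index_less[OF ij(2) ab(2)]
      by (simp add: block_odot_def)
    also have "\<dots> = (\<Sum>c<n. M $$ (i * n + a, j * n + c) * Gamma_mat n s $$ (i * n + c, j * n + b))"
      using ab by (simp add: mat_block_def scalar_prod_def lessThan_atLeast0)
    also have "\<dots> = (\<Sum>c<n. if c = b then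
        M $$ (i * n + a, j * n + c) * ([:0, 1:] ^ (s - i) * [:0, 1:] ^ (s - j)) else 0)"
      using ij ab by (intro sum.cong refl) (simp add: Gamma_mat_index del: mult_pCons_left mult_pCons_right)
    also have "\<dots> = M $$ (i * n + a, j * n + b) * ([:0, 1:] ^ (s - i) * [:0, 1:] ^ (s - j))"
      using ab by simp
    finally show ?thesis by (simp only: mult_ac)
  qed
  have "block_su n ?X $$ (a, b) = mat_sum n (\<lambda>(i, j). mat_block n ?X i j)
      {(i, j). i \<in> {1..s + 1} \<and> j \<in> {1..s + 1} \<and> True} $$ (a, b)"
  proof -
    \<comment> \<open>The positions \<open>a\<close> and \<open>b\<close> force
      \<open>n > 0\<close>, so division by \<open>n\<close> recovers the number of blocks.\<close>
    have "dim_row ?X div n = s + 1" "dim_col ?X div n = s + 1"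
      using M ab by (auto simp: block_odot_def)
    moreover have "{1..s + 1} \<times> {1..s + 1} = {(i, j). i \<in> {1..s + 1} \<and> j \<in> {1..s + 1} \<and> True}"
      by auto
    ultimately show ?thesis by (simp only: block_su_def)
  qed
  also have "\<dots> = (\<Sum>i<s + 1. \<Sum>j<s + 1. ?X $$ (i * n + a, j * n + b))"
    unfolding mat_sum_blocks[OF ab] by simp
  also have "\<dots> = (\<Sum>i<s + 1. \<Sum>j<s + 1. [:0, 1:] ^ (s - i) * [:0, 1:] ^ (s - j) * M $$ (i * n + a, j * n + b))"
    by (intro sum.cong refl X) auto
  finally show ?thesis .
qed

text \<open>With indices from 0, block \<open>(i, j)\<close> contributes
  \<open>x^(2s - i - j) * (A + x*B)\<close>. Its coefficient at \<open>k\<close> is the block of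
  \<open>A\<close> if \<open>i + j = 2s - k\<close> and that of \<open>B\<close> if
  \<open>i + j = 2s + 1 - k\<close>; raising both indices by 1 gives the antidiagonals of condition
  (a).\<close>

lemma antidiagonal_sums_index:
  fixes P :: "'a::comm_ring_1 poly mat"
  assumes P: "P \<in> carrier_mat n n" "mat_degree P = 2 * s + 1"
    and A: "A \<in> carrier_mat ((s + 1) * n) ((s + 1) * n)"
    and B: "B \<in> carrier_mat ((s + 1) * n) ((s + 1) * n)"
    and sums: "\<And>k. k \<le> 2 * s + 1 \<Longrightarrow>
      mat_sum n (\<lambda>(i, j). mat_block n B i j)
        {(i, j). i \<in> {1..s + 1} \<and> j \<in> {1..s + 1} \<and> i + j = 2 * s + 1 + 2 - k}
      + mat_sum n (\<lambda>(i, j). mat_block n A i j)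
        {(i, j). i \<in> {1..s + 1} \<and> j \<in> {1..s + 1} \<and> i + j = 2 * s + 1 + 1 - k}
      = coeff_mat P k"
    and ab: "a < n" "b < n"
  shows "P $$ (a, b) = (\<Sum>i<s + 1. \<Sum>j<s + 1.
    [:0, 1:] ^ (s - i) * [:0, 1:] ^ (s - j) * pencil B A $$ (i * n + a, j * n + b))"
proof (rule poly_eqI)
  fix k
  let ?A = "\<lambda>i j. A $$ (i * n + a, j * n + b)" and ?B = "\<lambda>i j. B $$ (i * n + a, j * n + b)"
  have lin: "coeff [:u, v:] k = (if k = 0 then u else if k = 1 then v else 0)" for u v :: 'a and k
    by (simp add: coeff_pCons split: nat.split)
  have pen: "pencil B A $$ (i * n + a, j * n + b) = [:?A i j, ?B i j:]" if "i < s + 1" "j < s + 1" for i j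
    using A B block_index_less[OF that(1) ab(1)] block_index_less[OF that(2) ab(2)]
    by (intro pencil_index) auto
  have "coeff (P $$ (a, b)) k = (\<Sum>i<s + 1. \<Sum>j<s + 1.
      coeff ([:0, 1:] ^ (s - i + (s - j)) * [:?A i j, ?B i j:]) k)"
  proof (cases "k \<le> 2 * s + 1")
    case True
    have "coeff (P $$ (a, b)) k = coeff_mat P k $$ (a, b)"
      using P ab by (simp add: coeff_mat_def)
    also have "\<dots> = (\<Sum>i<s + 1. \<Sum>j<s + 1. if Suc i + Suc j = 2 * s + 1 + 2 - k then ?B i j else 0)
        + (\<Sum>i<s + 1. \<Sum>j<s + 1. if Suc i + Suc j = 2 * s + 1 + 1 - k then ?A i j else 0)"
      unfolding sums[OF True, symmetric]
      using ab by (subst index_add_mat) (simp_all only: mat_sum_blocks[OF ab], simp_all add: mat_sum_def)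
    also have "\<dots> = (\<Sum>i<s + 1. \<Sum>j<s + 1.
        coeff ([:0, 1:] ^ (s - i + (s - j)) * [:?A i j, ?B i j:]) k)"
      unfolding sum.distrib[symmetric] coeff_x_power_mult lin
      by (intro sum.cong refl) (use True in auto)
    finally show ?thesis .
  next
    case False
    \<comment> \<open>Above \<open>2 * s + 1\<close> both sides vanish: the left by the degree of
      \<open>P\<close>, the right because the power is at most \<open>2 * s\<close> and the other
      factor is linear.\<close>
    have "coeff (P $$ (a, b)) k = 0"
      using False P ab by (intro coeff_eq_0_mat_degree) auto
    moreover have "coeff ([:0, 1:] ^ (s - i + (s - j)) * [:?A i j, ?B i j:]) k = 0" for i j
      unfolding coeff_x_power_mult lin using False by auto
    ultimately show ?thesis by (simp only: sum.neutral_const)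
  qed
  also have "\<dots> = coeff (\<Sum>i<s + 1. \<Sum>j<s + 1.
      [:0, 1:] ^ (s - i) * [:0, 1:] ^ (s - j) * pencil B A $$ (i * n + a, j * n + b)) k"
    unfolding coeff_sum power_add[symmetric]
    by (intro sum.cong refl arg_cong2[where f = coeff] arg_cong2[where f = "(*)"] pen[symmetric]) auto
  finally show "coeff (P $$ (a, b)) k = coeff (\<Sum>i<s + 1. \<Sum>j<s + 1.
      [:0, 1:] ^ (s - i) * [:0, 1:] ^ (s - j) * pencil B A $$ (i * n + a, j * n + b)) k" .
qed

section \<open>Reversal of \<open>P\<close> and of the block pencil\<close>

text \<open>Reversal with respect to a fixed degree is additive, so it can be applied to each block
  summand separately.\<close>

lemma mat_rev_index:
  fixes P :: "'a::comm_ring_1 poly mat"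
  assumes P: "P \<in> carrier_mat n n"
    and A: "A \<in> carrier_mat ((s + 1) * n) ((s + 1) * n)"
    and B: "B \<in> carrier_mat ((s + 1) * n) ((s + 1) * n)"
    and ab: "a < n" "b < n"
    and Pab: "P $$ (a, b) = (\<Sum>i<s + 1. \<Sum>j<s + 1.
      [:0, 1:] ^ (s - i) * [:0, 1:] ^ (s - j) * pencil B A $$ (i * n + a, j * n + b))"
  shows "mat_rev (2 * s + 1) P $$ (a, b) = (\<Sum>i<s + 1. \<Sum>j<s + 1.
      [:0, 1:] ^ i * [:0, 1:] ^ j * pencil A B $$ (i * n + a, j * n + b))"
proof (rule poly_eqI)
  fix m
  let ?d = "2 * s + 1"
  let ?t = "\<lambda>i j. [:0, 1:] ^ (s - i) * [:0, 1:] ^ (s - j) * pencil B A $$ (i * n + a, j * n + b)"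
  have rev: "(\<Sum>k\<le>?d. monom (coeff (?t i j) k) (?d - k)) =
      [:0, 1:] ^ i * [:0, 1:] ^ j * pencil A B $$ (i * n + a, j * n + b)" if "i < s + 1" "j < s + 1" for i j
  proof -
    have idx: "i * n + a < (s + 1) * n" "j * n + b < (s + 1) * n"
      using block_index_less that ab by blast+
    \<comment> \<open>The two exponents are complementary up to the 1 for the pencil; this exchanges
      the descending weights with the ascending ones.\<close>
    have d: "?d = (s - i + (s - j)) + (i + j) + 1" using that by simp
    have "pencil B A $$ (i * n + a, j * n + b) = [:A $$ (i * n + a, j * n + b), B $$ (i * n + a, j * n + b):]"
      "pencil A B $$ (i * n + a, j * n + b) = [:B $$ (i * n + a, j * n + b), A $$ (i * n + a, j * n + b):]"
      using A B idx by (auto intro!: pencil_index)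
    then show ?thesis
      unfolding power_add[symmetric] using rev_x_power_mult[OF d] by simp
  qed
  have "coeff (mat_rev ?d P $$ (a, b)) m = (if m \<le> ?d then coeff (P $$ (a, b)) (?d - m) else 0)"
    using P ab coeff_rev[of "P $$ (a, b)" ?d m] by (simp add: mat_rev_def)
  also have "\<dots> = (\<Sum>i<s + 1. \<Sum>j<s + 1. if m \<le> ?d then coeff (?t i j) (?d - m) else 0)"
    unfolding Pab coeff_sum by (cases "m \<le> ?d") simp_all
  also have "\<dots> = (\<Sum>i<s + 1. \<Sum>j<s + 1. coeff (\<Sum>k\<le>?d. monom (coeff (?t i j) k) (?d - k)) m)"
    by (intro sum.cong refl coeff_rev[symmetric])
  also have "\<dots> = (\<Sum>i<s + 1. \<Sum>j<s + 1.
      coeff ([:0, 1:] ^ i * [:0, 1:] ^ j * pencil A B $$ (i * n + a, j * n + b)) m)"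
    by (intro sum.cong refl arg_cong2[where f = coeff] rev) auto
  finally show "coeff (mat_rev ?d P $$ (a, b)) m = coeff (\<Sum>i<s + 1. \<Sum>j<s + 1.
      [:0, 1:] ^ i * [:0, 1:] ^ j * pencil A B $$ (i * n + a, j * n + b)) m"
    unfolding coeff_sum .
qed

text \<open>Every entry is linear, so reversal just exchanges its two coefficients; this is
  compatible with the constant factor and with the Kronecker product by the identity.\<close>

lemma mat_rev_block_kronecker_pencil:
  assumes A: "A \<in> carrier_mat ((s + 1) * n) ((s + 1) * n)"
    and B: "B \<in> carrier_mat ((s + 1) * n) ((s + 1) * n)"
  shows "mat_rev 1 (block_kronecker_pencil n s \<sigma> A B) =
    four_block_mat (pencil A B) (transpose_mat (mat_rev 1 (L_mat s)) \<otimes>\<^sub>K 1\<^sub>m n)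
      ([:\<sigma>:] \<cdot>\<^sub>m (mat_rev 1 (L_mat s) \<otimes>\<^sub>K 1\<^sub>m n)) (0\<^sub>m (s * n) (s * n))" (is "?l = ?r")
proof (rule eq_matI)
  let ?N = "(s + 1) * n"
  \<comment> \<open>\<open>L\<close> and \<open>K\<close> stay opaque: the four block cases use only
    their dimensions and that each entry of \<open>K\<close> is the entry of \<open>L\<close> with
    coefficients exchanged.\<close>
  define L where "L = (L_mat s :: 'a poly mat)"
  define K where "K = mat_rev 1 L"
  have dim: "dim_row (pencil X Y) = dim_row Y" "dim_col (pencil X Y) = dim_col Y" for X Y :: "'a mat"
    by (simp_all add: pencil_def const_mat_def)
  have L: "dim_row L = s" "dim_col L = s + 1"
    by (simp_all add: L_def L_mat_def)
  have K: "dim_row K = s" "dim_col K = s + 1"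
    "\<And>i j. i < s \<Longrightarrow> j < s + 1 \<Longrightarrow> K $$ (i, j) = [:coeff (L $$ (i, j)) 1, coeff (L $$ (i, j)) 0:]"
    using L unfolding K_def by (simp add: mat_rev_def, simp add: mat_rev_def, subst mat_rev_one_index, auto)
  have l: "?l = mat_rev 1 (four_block_mat (pencil B A) (transpose_mat L \<otimes>\<^sub>K 1\<^sub>m n)
      ([:\<sigma>:] \<cdot>\<^sub>m (L \<otimes>\<^sub>K 1\<^sub>m n)) (0\<^sub>m (s * n) (s * n)))" (is "_ = mat_rev 1 ?p")
    by (simp add: block_kronecker_pencil_def L_def)
  have r: "?r = four_block_mat (pencil A B) (transpose_mat K \<otimes>\<^sub>K 1\<^sub>m n)
      ([:\<sigma>:] \<cdot>\<^sub>m (K \<otimes>\<^sub>K 1\<^sub>m n)) (0\<^sub>m (s * n) (s * n))" (is "_ = ?q")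
    by (simp add: K_def L_def)
  show "dim_row ?l = dim_row ?r" "dim_col ?l = dim_col ?r"
    using A B by (simp_all add: block_kronecker_pencil_def mat_rev_def dim)
  fix i j assume "i < dim_row ?r" "j < dim_col ?r"
  then have ij: "i < ?N + s * n" "j < ?N + s * n"
    using A B by (simp_all add: dim)
  have "mat_rev 1 ?p $$ (i, j) = [:coeff (?p $$ (i, j)) 1, coeff (?p $$ (i, j)) 0:]"
    using ij A B by (intro mat_rev_one_index) (auto simp: dim)
  also have "\<dots> = ?q $$ (i, j)"
  proof -
    consider "i < ?N" "j < ?N" | "i < ?N" "\<not> j < ?N" "j - ?N < s * n"
      | "\<not> i < ?N" "j < ?N" "i - ?N < s * n" | "\<not> i < ?N" "\<not> j < ?N" "i - ?N < s * n" "j - ?N < s * n"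
      using ij by linarith
    then show ?thesis
    proof cases
      case 1
      then show ?thesis using A B by (simp add: dim pencil_index)
    next
      case 2
      then show ?thesis
        using A B L K ij div_mod_less[of i "s + 1" n] div_mod_less[of "j - ?N" s n]
        by (simp add: dim kronecker_one_index del: One_nat_def)
    next
      case 3
      then show ?thesis
        using A B L K ij div_mod_less[of "i - ?N" s n] div_mod_less[of j "s + 1" n]
        by (simp add: dim kronecker_one_index del: One_nat_def)
    next
      case 4
      then show ?thesis using A B ij by (simp add: dim)
    qed
  qed
  finally show "?l $$ (i, j) = ?r $$ (i, j)" unfolding l r .
qed

section \<open>Strong linearization from either condition\<close>

theorem corollary4p6:
  fixes P :: "'a::field poly mat" and A B :: "'a mat" and \<sigma> :: 'a and n d s :: nat
  assumes "P \<in> carrier_mat n n"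
    and "mat_degree P = d"
    and "odd d"
    and "s = (d - 1) div 2"
    and "s \<ge> 1"
    and "\<sigma> \<in> {1, - 1}"
    and "A \<in> carrier_mat ((s + 1) * n) ((s + 1) * n)"
    and "B \<in> carrier_mat ((s + 1) * n) ((s + 1) * n)"
    and "(\<forall>k \<in> {0..d}.
            mat_sum n (\<lambda>(i, j). mat_block n B i j)
              {(i, j). i \<in> {1..s + 1} \<and> j \<in> {1..s + 1} \<and> i + j = d + 2 - k}
          + mat_sum n (\<lambda>(i, j). mat_block n A i j)
              {(i, j). i \<in> {1..s + 1} \<and> j \<in> {1..s + 1} \<and> i + j = d + 1 - k}
          = coeff_mat P k)
       \<or> P = block_su n (block_odot n (pencil B A) (Gamma_mat n s))"
  shows "is_strong_linearization (block_kronecker_pencil n s \<sigma> A B) P"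
proof -
  let ?L = "block_kronecker_pencil n s \<sigma> A B"
  have d: "d = 2 * s + 1" using assms(3,4) by presburger
  have P: "P \<in> carrier_mat n n" and A: "A \<in> carrier_mat ((s + 1) * n) ((s + 1) * n)"
    and B: "B \<in> carrier_mat ((s + 1) * n) ((s + 1) * n)" using assms(1,7,8) by auto
  \<comment> \<open>The sign is its own inverse, so it serves as both \<open>c\<close> and
    \<open>c'\<close> in the elimination.\<close>
  have c: "[:\<sigma>:] * [:\<sigma>:] = 1" using assms(6) by (auto simp: one_pCons)
  have M: "pencil B A \<in> carrier_mat ((s + 1) * n) ((s + 1) * n)"
    "pencil A B \<in> carrier_mat ((s + 1) * n) ((s + 1) * n)"
    using A B by (auto simp: pencil_def const_mat_def)
  \<comment> \<open>Both conditions lead to this one formula; it feeds the elimination directly and,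
    once reversed, that of the reversed pencil.\<close>
  have Pab: "P $$ (a, b) = (\<Sum>i<s + 1. \<Sum>j<s + 1.
      [:0, 1:] ^ (s - i) * [:0, 1:] ^ (s - j) * pencil B A $$ (i * n + a, j * n + b))"
    if ab: "a < n" "b < n" for a b
    using assms(9)
  proof
    assume "P = block_su n (block_odot n (pencil B A) (Gamma_mat n s))"
    then show ?thesis using block_su_odot_Gamma_index[OF M(1) ab] by simp
  next
    assume "\<forall>k \<in> {0..d}.
            mat_sum n (\<lambda>(i, j). mat_block n B i j)
              {(i, j). i \<in> {1..s + 1} \<and> j \<in> {1..s + 1} \<and> i + j = d + 2 - k}
          + mat_sum n (\<lambda>(i, j). mat_block n A i j)
              {(i, j). i \<in> {1..s + 1} \<and> j \<in> {1..s + 1} \<and> i + j = d + 1 - k}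
          = coeff_mat P k"
    then show ?thesis
      using assms(2) ab unfolding d by (intro antidiagonal_sums_index[OF P _ A B]) auto
  qed
  have rP: "mat_rev d P \<in> carrier_mat n n" using P by (simp add: mat_rev_def)
  have "unimodular_equiv ?L (diag_block2 (1\<^sub>m (s * n + s * n)) P)"
    unfolding block_kronecker_pencil_def by (rule block_kronecker_L_equiv[OF M(1) c P Pab])
  moreover have "is_pencil ?L"
  proof (rule is_pencilI)
    fix i j assume "i < dim_row ?L" "j < dim_col ?L"
    then show "degree (?L $$ (i, j)) \<le> 1"
      using A B M div_mod_less
      by (auto simp: block_kronecker_pencil_def pencil_index kronecker_one_index L_mat_def)
  qed
  ultimately have "is_linearization ?L P" by (intro is_linearizationI)
  moreover have "unimodular_equiv (mat_rev 1 ?L) (diag_block2 (1\<^sub>m (s * n + s * n)) (mat_rev d P))"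
    unfolding mat_rev_block_kronecker_pencil[OF A B]
    by (rule block_kronecker_rev_L_equiv[OF M(2) c rP])
      (unfold d, rule mat_rev_index[OF P A B _ _ Pab])
  moreover have "is_pencil (mat_rev 1 ?L)"
  proof (rule is_pencilI)
    fix i j assume "i < dim_row (mat_rev 1 ?L)" "j < dim_col (mat_rev 1 ?L)"
    then have "i < dim_row ?L" "j < dim_col ?L" by (auto simp: mat_rev_def)
    then show "degree (mat_rev 1 ?L $$ (i, j)) \<le> 1" by (subst mat_rev_one_index) auto
  qed
  ultimately show ?thesis
    unfolding is_strong_linearization_def assms(2) using is_linearizationI by blast
qed

end
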